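(* Let $\mu_1$ and $\mu_3$ be probability measures on $\mathbb{R}$ with finite variances $\sigma_1^2$ and $\sigma_3^2$ respectively. There exist unique functions $\omega_1,\omega_3:\mathbb{C}_{2\sqrt2\sigma_1}\to\mathbb{C}^+$ such that: (1) $\Im\,\omega_j(z)\ge \frac12\Im z$ for $z\in\mathbb{C}_{2\sqrt2\sigma_1}$, and $\lim_{y\to\infty}\frac{\omega_j(iy)}{iy}=1$, for $j=1,3$. (2) If $\mu_2$ is a probability measure on $\mathbb{R}$ such that $\mu_1\boxplus\mu_2=\mu_3$, then $F_{\mu_2}(z)=F_{\mu_3}(\omega_3(z))=F_{\mu_1}(\omega_1(z))$ for all $z\in\mathbb{C}_{2\sqrt2\sigma_1}$. (3) $\omega_1(z)-\omega_3(z)=F_{\mu_3}(\omega_3(z))-z$ for all $z\in\mathbb{C}_{2\sqrt2\sigma_1}$. (4) For $z\in\mathbb{C}_{2\sqrt2\sigma_1}$ let $h_1(w)=w-F_{\mu_1}(w)$, $\tilde h_3(w)=F_{\mu_3}(w)+w$ and $T_z(w)=h_1(\tilde h_3(w)-z)+z$. Then for any $w$ with $\Im w>\frac34\Im z$, the iterates $T_z^{\circ n}(w)$ converge, as $n\to\infty$, to $\omega_3(z)\in\mathbb{C}^+$, independently of $w$.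
   Context: $\mathbb{C}^+$ and $\mathbb{C}^-$ are the open upper and lower half-planes; for real $\sigma$, $\mathbb{C}_\sigma=\{z\in\mathbb{C}:\Im z>\sigma\}$. For a probability measure $\mu$ on $\mathbb{R}$, $G_\mu(z)=\int_{\mathbb{R}}\frac{1}{z-t}\,d\mu(t)$ for $z\in\mathbb{C}^+$ is its Cauchy transform and $F_\mu=1/G_\mu:\mathbb{C}^+\to\mathbb{C}^+$. $\boxplus$ is the free additive convolution of probability measures on $\mathbb{R}$, characterized by $\phi_{\mu\boxplus\nu}=\phi_\mu+\phi_\nu$ on a common domain, where $\phi_\mu(z)=F_\mu^{\langle-1\rangle}(z)-z$ is the Voiculescu transform ($F_\mu^{\langle -1\rangle}$ is the compositional inverse of $F_\mu$ near infinity). $T^{\circ n}$ denotes the $n$-fold composition. *)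

theory Defs
  imports "HOL-Probability.Probability"
begin

definition half_plane :: "real \<Rightarrow> complex set" where
  "half_plane s = {z. s < Im z}"

definition Cauchy_transform :: "real measure \<Rightarrow> complex \<Rightarrow> complex" where
  "Cauchy_transform \<mu> z = (LINT t|\<mu>. 1 / (z - complex_of_real t))"

definition F_transform :: "real measure \<Rightarrow> complex \<Rightarrow> complex" where
  "F_transform \<mu> z = 1 / Cauchy_transform \<mu> z"

text \<open>Near infinity, \<open>F_transform \<mu>\<close> is in general invertible only on truncated
  cones (nontangential neighbourhoods of infinity in the upper half-plane).\<close>

definition truncated_cone :: "real \<Rightarrow> real \<Rightarrow> complex set" where
  "truncated_cone \<alpha> \<beta> = {z. \<beta> < Im z \<and> \<bar>Re z\<bar> < \<alpha> * Im z}"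

text \<open>\<open>\<phi>\<close> is the Voiculescu transform of \<open>\<mu>\<close> on \<open>D\<close>: the function \<open>F_transform \<mu>\<close> is
  injective on some truncated cone whose image contains \<open>D\<close>, and \<open>\<phi> z\<close> is the
  value at \<open>z\<close> of the inverse of that restriction, minus \<open>z\<close>. When \<open>D\<close> is itself a
  truncated cone, \<open>\<phi>\<close> does not depend on the cone chosen for the inversion: any two
  such inverses agree at the points \<open>\<i> y\<close> with \<open>y\<close> large, hence on \<open>D\<close> by analytic
  continuation.\<close>

definition Voiculescu_transform_on ::
    "real measure \<Rightarrow> complex set \<Rightarrow> (complex \<Rightarrow> complex) \<Rightarrow> bool" where
  "Voiculescu_transform_on \<mu> D \<phi> \<longleftrightarrow>
     (\<exists>\<alpha>>0. \<exists>\<beta>>0.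
        inj_on (F_transform \<mu>) (truncated_cone \<alpha> \<beta>) \<and>
        D \<subseteq> F_transform \<mu> ` truncated_cone \<alpha> \<beta> \<and>
        (\<forall>z\<in>D. \<phi> z = the_inv_into (truncated_cone \<alpha> \<beta>) (F_transform \<mu>) z - z))"

text \<open>\<open>free_additive_convolution \<mu> \<nu> \<rho>\<close> expresses that the free additive convolution of
  the probability measures \<open>\<mu>\<close> and \<open>\<nu>\<close> is the probability measure \<open>\<rho>\<close>. The measure
  \<open>\<rho>\<close> is determined by \<open>\<mu>\<close> and \<open>\<nu>\<close>, since its Voiculescu transform on a truncated cone
  determines its Cauchy transform.\<close>

definition free_additive_convolution ::
    "real measure \<Rightarrow> real measure \<Rightarrow> real measure \<Rightarrow> bool" where
  "free_additive_convolution \<mu> \<nu> \<rho> \<longleftrightarrow>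
     (\<exists>\<alpha>>0. \<exists>\<beta>>0. \<exists>\<phi>\<^sub>\<mu> \<phi>\<^sub>\<nu> \<phi>\<^sub>\<rho>.
        Voiculescu_transform_on \<mu> (truncated_cone \<alpha> \<beta>) \<phi>\<^sub>\<mu> \<and>
        Voiculescu_transform_on \<nu> (truncated_cone \<alpha> \<beta>) \<phi>\<^sub>\<nu> \<and>
        Voiculescu_transform_on \<rho> (truncated_cone \<alpha> \<beta>) \<phi>\<^sub>\<rho> \<and>
        (\<forall>z\<in>truncated_cone \<alpha> \<beta>. \<phi>\<^sub>\<rho> z = \<phi>\<^sub>\<mu> z + \<phi>\<^sub>\<nu> z))"

definition h_fun :: "real measure \<Rightarrow> complex \<Rightarrow> complex" where
  "h_fun \<mu> w = w - F_transform \<mu> w"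

definition h_tilde :: "real measure \<Rightarrow> complex \<Rightarrow> complex" where
  "h_tilde \<mu> w = F_transform \<mu> w + w"

definition T_map :: "real measure \<Rightarrow> real measure \<Rightarrow> complex \<Rightarrow> complex \<Rightarrow> complex" where
  "T_map \<mu>\<^sub>1 \<mu>\<^sub>3 z w = h_fun \<mu>\<^sub>1 (h_tilde \<mu>\<^sub>3 w - z) + z"

end

theory Submission
  imports Defs "HOL-Complex_Analysis.Complex_Analysis" "HOL-Real_Asymp.Real_Asymp"
begin

text \<open>
For a probability measure with reciprocal Cauchy transform \<open>F\<close>, the \<^emph>\<open>centred resolvent\<close>
\<open>r\<^sub>z(t) = F(z) / (z - t) - 1\<close> is bounded, has mean zero and satisfies three identities: its squared
\<open>L\<^sup>2\<close>-norm is \<open>Im F(z) / Im z - 1\<close>; the difference quotient of \<open>F\<close> at \<open>u\<close>, \<open>v\<close> is one plus the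
integral of \<open>r\<^sub>u r\<^sub>v\<close>; and if the measure has mean \<open>m\<close> and variance \<open>\<sigma>\<^sup>2\<close>, the integral of
\<open>(t - m) r\<^sub>z(t)\<close> is \<open>h(z) - m\<close> with \<open>h(z) = z - F(z)\<close>. The Cauchy-Schwarz inequality turns them into
all estimates that are needed: \<open>|h(z) - m| \<le> \<sigma>\<^sup>2 / Im z\<close>,
\<open>|h(u) - h(v)| \<le> \<sigma>\<^sup>2 |u - v| / (Im u Im v)\<close>, and a Schwarz-Pick bound for the increments of
\<open>F(w) + w\<close>.

For \<open>y = Im z > 2 sqrt 2 \<sigma>\<^sub>1\<close> these bounds show that \<open>T\<^sub>z\<close> maps the closed half-plane
\<open>Im w \<ge> 3 y / 4\<close> into itself (\<open>Im_T_map_ge\<close>) and contracts Euclidean distances there by the factor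
\<open>8 \<sigma>\<^sub>1\<^sup>2 / y\<^sup>2 < 1\<close> (\<open>T_map_contraction\<close>). Banach's theorem gives the fixed point \<open>\<omega>\<^sub>3(z)\<close>
and the convergence of the iterates. Setting \<open>\<omega>\<^sub>1(z) = F(\<omega>\<^sub>3(z)) + \<omega>\<^sub>3(z) - z\<close>, with the transform of
\<open>\<mu>\<^sub>3\<close>, the fixed point equation becomes the equality of the transforms of \<open>\<mu>\<^sub>3\<close> at \<open>\<omega>\<^sub>3(z)\<close> and of
\<open>\<mu>\<^sub>1\<close> at \<open>\<omega>\<^sub>1(z)\<close>. Both functions stay within a bounded distance of the identity on the upper
imaginary axis near infinity, hence the asymptotics. Uniqueness holds because the convergence of
the iterates determines \<open>\<omega>\<^sub>3\<close>, which in turn determines \<open>\<omega>\<^sub>1\<close>.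

If \<open>\<mu>\<^sub>1\<close> and \<open>\<mu>\<^sub>2\<close> convolve to \<open>\<mu>\<^sub>3\<close>, then additivity of the Voiculescu transforms at \<open>\<i> s\<close>, for
\<open>s\<close> large, exhibits the preimage of \<open>\<i> s\<close> for \<open>\<mu>\<^sub>3\<close> as the fixed point of \<open>T\<^sub>z\<close>, where \<open>z\<close> is the
preimage for \<open>\<mu>\<^sub>2\<close>. This yields the subordination identity at uncountably many points \<open>z\<close>
(\<open>subordination_on_imaginary_axis\<close>). Since \<open>\<omega>\<^sub>3\<close> is holomorphic, as a locally uniform limit of
holomorphic iterates, the identity theorem extends it to the whole half-plane.
\<close>

section \<open>The Cauchy-Schwarz inequality for complex integrals\<close>

lemma norm_integral_mult_le_sqrt:
  fixes f g :: "'a \<Rightarrow> complex"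
  assumes [measurable]: "f \<in> borel_measurable M" "g \<in> borel_measurable M"
    and f2: "integrable M (\<lambda>x. (cmod (f x))\<^sup>2)" and g2: "integrable M (\<lambda>x. (cmod (g x))\<^sup>2)"
  shows "cmod (LINT x|M. f x * g x)
    \<le> sqrt ((LINT x|M. (cmod (f x))\<^sup>2) * (LINT x|M. (cmod (g x))\<^sup>2))"
proof -
  let ?A = "LINT x|M. (cmod (f x))\<^sup>2" and ?B = "LINT x|M. (cmod (g x))\<^sup>2"
  let ?J = "LINT x|M. cmod (f x) * cmod (g x)"
  have le: "cmod (f x) * cmod (g x) \<le> (cmod (f x))\<^sup>2 + (cmod (g x))\<^sup>2" for x
    using sum_squares_bound[of "cmod (f x)" "cmod (g x)"]
      mult_nonneg_nonneg[OF norm_ge_zero norm_ge_zero, of "f x" "g x"] by linarith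
  have int: "integrable M (\<lambda>x. cmod (f x) * cmod (g x))"
    by (rule Bochner_Integration.integrable_bound[OF Bochner_Integration.integrable_add[OF f2 g2]])
      (use le in \<open>auto simp: abs_mult\<close>)
  have "(\<integral>\<^sup>+x. ennreal (cmod (f x)) * ennreal (cmod (g x)) \<partial>M)\<^sup>2
      \<le> (\<integral>\<^sup>+x. (ennreal (cmod (f x)))\<^sup>2 \<partial>M) * (\<integral>\<^sup>+x. (ennreal (cmod (g x)))\<^sup>2 \<partial>M)"
    by (rule Cauchy_Schwarz_nn_integral) auto
  also have "(\<integral>\<^sup>+x. ennreal (cmod (f x)) * ennreal (cmod (g x)) \<partial>M) = ennreal ?J"
    using nn_integral_eq_integral[OF int] by (simp add: ennreal_mult)
  also have "(\<integral>\<^sup>+x. (ennreal (cmod (f x)))\<^sup>2 \<partial>M) = ennreal ?A"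
    using nn_integral_eq_integral[OF f2] by (simp add: ennreal_power)
  also have "(\<integral>\<^sup>+x. (ennreal (cmod (g x)))\<^sup>2 \<partial>M) = ennreal ?B"
    using nn_integral_eq_integral[OF g2] by (simp add: ennreal_power)
  finally have "?J\<^sup>2 \<le> ?A * ?B"
    by (simp add: ennreal_power flip: ennreal_mult)
  then have "?J \<le> sqrt (?A * ?B)"
    by (rule real_le_rsqrt)
  moreover have "cmod (LINT x|M. f x * g x) \<le> ?J"
    using integral_norm_bound[of M "\<lambda>x. f x * g x"] by (simp add: norm_mult)
  ultimately show ?thesis by linarith
qed

section \<open>The centred resolvent and the reciprocal Cauchy transform\<close>

lemma norm_diff_of_real_ge_Im: "\<bar>Im z\<bar> \<le> cmod (z - complex_of_real t)"
  using abs_Im_le_cmod[of "z - complex_of_real t"] by simp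

lemma diff_of_real_nonzero: "0 < Im z \<Longrightarrow> z - complex_of_real t \<noteq> 0"
  by (auto simp: complex_eq_iff)

text \<open>In \<open>L\<^sup>2(\<mu>)\<close> let \<open>P\<close> be the orthogonal projection onto the complement of the constants
and \<open>X\<close> multiplication by \<open>t\<close>. The function below has mean zero, and its product with \<open>z - t\<close> is
the constant \<open>F(z) - z\<close> plus \<open>t\<close>; hence, when \<open>t\<close> is square integrable, it is the solution \<open>f\<close> of
\<open>(z - P X P) f = P t\<close> in the range of \<open>P\<close>. Written in terms of \<open>F\<close> it is bounded, so it
makes sense for every probability measure.\<close>

definition centred_resolvent :: "real measure \<Rightarrow> complex \<Rightarrow> real \<Rightarrow> complex" where
  "centred_resolvent \<mu> z t = F_transform \<mu> z / (z - complex_of_real t) - 1"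

text \<open>The squared \<open>L\<^sup>2\<close>-norm of the centred resolvent. It measures the deviation of \<open>F\<close>
from a real translation, for which it vanishes.\<close>

definition relative_excess :: "real measure \<Rightarrow> complex \<Rightarrow> real" where
  "relative_excess \<mu> z = Im (F_transform \<mu> z) / Im z - 1"

context real_distribution
begin

lemma centred_resolvent_measurable [measurable]:
  "centred_resolvent M z \<in> borel_measurable M"
  unfolding centred_resolvent_def by simp

lemma norm_kernel_le:
  assumes "0 < Im z"
  shows "cmod (1 / (z - complex_of_real t)) \<le> 1 / Im z"
  using norm_diff_of_real_ge_Im[of z t] assms by (simp add: norm_divide frac_le)

lemma integrable_kernel:
  assumes "0 < Im z"
  shows "integrable M (\<lambda>t. 1 / (z - complex_of_real t))"
  by (rule integrable_const_bound[of _ "1 / Im z"]) (use norm_kernel_le[OF assms] in auto)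

lemma integrable_kernel_mult:
  assumes "0 < Im u" "0 < Im v"
  shows "integrable M (\<lambda>t. 1 / (u - complex_of_real t) * (1 / (v - complex_of_real t)))"
proof (rule integrable_const_bound[of _ "1 / Im u * (1 / Im v)"])
  show "AE t in M. cmod (1 / (u - complex_of_real t) * (1 / (v - complex_of_real t)))
      \<le> 1 / Im u * (1 / Im v)"
    unfolding norm_mult
    by (intro AE_I2 mult_mono norm_kernel_le assms) (use assms in auto)
qed auto

lemma Cauchy_transform_diff:
  assumes "0 < Im u" "0 < Im v"
  shows "Cauchy_transform M u - Cauchy_transform M v
    = (v - u) * (LINT t|M. 1 / (u - complex_of_real t) * (1 / (v - complex_of_real t)))"
proof -
  have "1 / (u - complex_of_real t) - 1 / (v - complex_of_real t)
      = (v - u) * (1 / (u - complex_of_real t) * (1 / (v - complex_of_real t)))" for t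
    using diff_of_real_nonzero[OF assms(1), of t] diff_of_real_nonzero[OF assms(2), of t]
    by (simp add: divide_simps)
  then show ?thesis
    unfolding Cauchy_transform_def
    by (simp add: integrable_kernel assms flip: Bochner_Integration.integral_diff
         del: times_divide_eq_right mult_1_right)
qed

lemma Im_Cauchy_transform:
  assumes "0 < Im z"
  shows "Im (Cauchy_transform M z) = - Im z * (LINT t|M. (cmod (1 / (z - complex_of_real t)))\<^sup>2)"
proof -
  have "Im (1 / (z - complex_of_real t)) = - Im z * (cmod (1 / (z - complex_of_real t)))\<^sup>2" for t
    by (simp add: Im_divide norm_divide power_divide cmod_power2)
  then have "(LINT t|M. Im (1 / (z - complex_of_real t)))
      = - Im z * (LINT t|M. (cmod (1 / (z - complex_of_real t)))\<^sup>2)"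
    by simp
  then show ?thesis
    unfolding Cauchy_transform_def using integrable_kernel[OF assms] by simp
qed

lemma integrable_norm_kernel_sq:
  assumes "0 < Im z"
  shows "integrable M (\<lambda>t. (cmod (1 / (z - complex_of_real t)))\<^sup>2)"
  by (rule integrable_const_bound[of _ "(1 / Im z)\<^sup>2"])
    (use norm_kernel_le[OF assms] in \<open>auto intro!: power_mono\<close>)

lemma Cauchy_transform_nonzero:
  assumes "0 < Im z"
  shows "Cauchy_transform M z \<noteq> 0"
proof
  assume "Cauchy_transform M z = 0"
  then have "(LINT t|M. (cmod (1 / (z - complex_of_real t)))\<^sup>2) = 0"
    using Im_Cauchy_transform[OF assms] assms by simp
  then have "AE t in M. (cmod (1 / (z - complex_of_real t)))\<^sup>2 = 0"
    using integral_nonneg_eq_0_iff_AE[OF integrable_norm_kernel_sq[OF assms]] by simp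
  then have "AE t in M. False"
    by (rule AE_mp) (use diff_of_real_nonzero[OF assms] in auto)
  then show False by simp
qed

text \<open>The resolvent identity, which turns the difference quotient of \<open>F\<close> into an
\<open>L\<^sup>2\<close> pairing. The \<open>1\<close> is the linear part of \<open>F\<close>, so what remains controls the
increments of both \<open>w - F(w)\<close> and \<open>w + F(w)\<close>.\<close>

lemma F_transform_diff:
  assumes "0 < Im u" "0 < Im v"
  shows "F_transform M u - F_transform M v
    = (u - v) * (1 + (LINT t|M. centred_resolvent M u t * centred_resolvent M v t))"
proof -
  let ?gu = "\<lambda>t. 1 / (u - complex_of_real t)" and ?gv = "\<lambda>t. 1 / (v - complex_of_real t)"
  let ?Fu = "F_transform M u" and ?Fv = "F_transform M v"
  let ?Gu = "Cauchy_transform M u" and ?Gv = "Cauchy_transform M v"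
  let ?K = "LINT t|M. ?gu t * ?gv t"
  have nz: "?Gu \<noteq> 0" "?Gv \<noteq> 0"
    using Cauchy_transform_nonzero assms by auto
  have "(\<lambda>t. centred_resolvent M u t * centred_resolvent M v t) =
     (\<lambda>t. ?Fu * ?Fv * (?gu t * ?gv t) - ?Fu * ?gu t - ?Fv * ?gv t + 1)"
    by (auto simp: centred_resolvent_def algebra_simps fun_eq_iff)
  then have "(LINT t|M. centred_resolvent M u t * centred_resolvent M v t)
      = ?Fu * ?Fv * ?K - ?Fu * ?Gu - ?Fv * ?Gv + 1"
    unfolding Cauchy_transform_def
    using integrable_kernel_mult[OF assms] integrable_kernel[OF assms(1)] integrable_kernel[OF assms(2)]
    by (simp del: times_divide_times_eq times_divide_eq_right mult_1_right add: prob_space[unfolded space_eq_univ])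
  also have "\<dots> = ?Fu * ?Fv * ?K - 1"
    using nz by (simp add: F_transform_def)
  finally have "(u - v) * (1 + (LINT t|M. centred_resolvent M u t * centred_resolvent M v t))
      = - (?Fu * ?Fv) * ((v - u) * ?K)"
    by (simp add: algebra_simps)
  also have "\<dots> = - (?Fu * ?Fv) * (?Gu - ?Gv)"
    by (simp only: Cauchy_transform_diff[OF assms])
  also have "\<dots> = ?Fu - ?Fv"
    using nz by (simp add: F_transform_def field_simps)
  finally show ?thesis by simp
qed

lemma bounded_centred_resolvent:
  assumes "0 < Im z"
  shows "cmod (centred_resolvent M z t) \<le> cmod (F_transform M z) / Im z + 1"
proof -
  have "cmod (centred_resolvent M z t) \<le> cmod (F_transform M z * (1 / (z - complex_of_real t))) + 1"
    unfolding centred_resolvent_def using norm_triangle_ineq4[of "F_transform M z * (1 / (z - complex_of_real t))" 1]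
    by simp
  also have "\<dots> \<le> cmod (F_transform M z) * (1 / Im z) + 1"
    unfolding norm_mult using norm_kernel_le[OF assms, of t] by (intro add_right_mono mult_left_mono) auto
  finally show ?thesis by simp
qed

lemma integrable_norm_centred_resolvent_sq:
  assumes "0 < Im z"
  shows "integrable M (\<lambda>t. (cmod (centred_resolvent M z t))\<^sup>2)"
  by (rule integrable_const_bound[of _ "(cmod (F_transform M z) / Im z + 1)\<^sup>2"])
    (use bounded_centred_resolvent[OF assms] in \<open>auto intro!: power_mono\<close>)

text \<open>Expanding the square produces the integral of \<open>1 / |z - t|\<^sup>2\<close>, which is
\<open>- Im G(z) / Im z\<close>, and multiplying by \<open>|F(z)|\<^sup>2\<close> turns this into \<open>Im F(z) / Im z\<close>.
The cross term and the constant contribute \<open>-2 + 1\<close>, because \<open>F G = 1\<close>.\<close>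

lemma integral_norm_centred_resolvent_sq:
  assumes "0 < Im z"
  shows "(LINT t|M. (cmod (centred_resolvent M z t))\<^sup>2) = relative_excess M z"
proof -
  let ?g = "\<lambda>t. 1 / (z - complex_of_real t)"
  let ?F = "F_transform M z" and ?G = "Cauchy_transform M z"
  have nz: "?G \<noteq> 0"
    using Cauchy_transform_nonzero assms by auto
  have "(cmod (centred_resolvent M z t))\<^sup>2 = (cmod ?F)\<^sup>2 * (cmod (?g t))\<^sup>2 - 2 * Re (?F * ?g t) + 1" for t
  proof -
    have "(cmod (a - 1))\<^sup>2 = (cmod a)\<^sup>2 - 2 * Re a + 1" for a
      unfolding cmod_power2 by (simp add: power2_eq_square algebra_simps)
    from this[of "?F * ?g t"] show ?thesis
      by (simp add: centred_resolvent_def norm_mult norm_divide power_mult_distrib power_divide)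
  qed
  then have "(LINT t|M. (cmod (centred_resolvent M z t))\<^sup>2)
      = (LINT t|M. (cmod ?F)\<^sup>2 * (cmod (?g t))\<^sup>2 - 2 * Re (?F * ?g t) + 1)"
    by presburger
  also have "\<dots> = (LINT t|M. (cmod ?F)\<^sup>2 * (cmod (?g t))\<^sup>2) - (LINT t|M. 2 * Re (?F * ?g t)) + 1"
    using integrable_kernel[OF assms] integrable_norm_kernel_sq[OF assms]
    by (simp del: times_divide_times_eq times_divide_eq_right mult_1_right add: prob_space[unfolded space_eq_univ])
  also have "(LINT t|M. 2 * Re (?F * ?g t)) = 2 * Re (?F * ?G)"
    unfolding Cauchy_transform_def using integrable_kernel[OF assms]
    by (simp del: times_divide_times_eq times_divide_eq_right mult_1_right times_complex.sel)
  also have "?F * ?G = 1"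
    using nz by (simp add: F_transform_def)
  also have "(LINT t|M. (cmod ?F)\<^sup>2 * (cmod (?g t))\<^sup>2) = (cmod ?F)\<^sup>2 * (LINT t|M. (cmod (?g t))\<^sup>2)"
    by simp
  also have "(LINT t|M. (cmod (?g t))\<^sup>2) = - Im ?G / Im z"
    using Im_Cauchy_transform[OF assms] assms by simp
  also have "(cmod ?F)\<^sup>2 * (- Im ?G / Im z) = Im ?F / Im z"
    by (simp add: F_transform_def Im_divide norm_divide power_divide cmod_power2)
  finally show ?thesis by (simp add: relative_excess_def)
qed

lemma relative_excess_nonneg: "0 < Im z \<Longrightarrow> 0 \<le> relative_excess M z"
  by (simp flip: integral_norm_centred_resolvent_sq)

lemma Im_F_transform_ge: "0 < Im z \<Longrightarrow> Im z \<le> Im (F_transform M z)"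
  using relative_excess_nonneg[of z] by (simp add: relative_excess_def field_simps)

text \<open>A quantitative Schwarz-Pick inequality, coming from Cauchy-Schwarz alone.\<close>

lemma norm_F_transform_diff_minus_diff_le:
  assumes "0 < Im u" "0 < Im v"
  shows "cmod ((F_transform M u - F_transform M v) - (u - v))
    \<le> cmod (u - v) * sqrt (relative_excess M u * relative_excess M v)"
proof -
  let ?I = "LINT t|M. centred_resolvent M u t * centred_resolvent M v t"
  have "cmod ?I \<le> sqrt (relative_excess M u * relative_excess M v)"
    using norm_integral_mult_le_sqrt[of "centred_resolvent M u" M "centred_resolvent M v"] assms
    by (simp add: integrable_norm_centred_resolvent_sq integral_norm_centred_resolvent_sq)
  moreover have "(F_transform M u - F_transform M v) - (u - v) = (u - v) * ?I"
    using F_transform_diff[OF assms] by (simp add: algebra_simps)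
  ultimately show ?thesis
    by (simp add: norm_mult mult_left_mono)
qed

text \<open>The form \<open>sqrt (2 + x) * sqrt (2 + y)\<close>, with one factor for each point, lets the contraction
estimate be checked at one point at a time; it comes from \<open>2 sqrt (x y) \<le> x + y\<close>.\<close>

lemma norm_h_tilde_diff_le:
  assumes "0 < Im u" "0 < Im v"
  shows "cmod (h_tilde M u - h_tilde M v)
    \<le> cmod (u - v) * sqrt ((2 + relative_excess M u) * (2 + relative_excess M v))"
proof -
  let ?x = "relative_excess M u" and ?y = "relative_excess M v"
  have x: "0 \<le> ?x" and y: "0 \<le> ?y"
    using relative_excess_nonneg assms by auto
  have "(2 + sqrt (?x * ?y))\<^sup>2 \<le> (2 + ?x) * (2 + ?y)"
    using x y arith_geo_mean_sqrt[OF x y] by (simp add: power2_eq_square algebra_simps)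
  then have "2 + sqrt (?x * ?y) \<le> sqrt ((2 + ?x) * (2 + ?y))"
    by (rule real_le_rsqrt)
  moreover have "cmod (h_tilde M u - h_tilde M v)
      \<le> cmod (2 * (u - v)) + cmod ((F_transform M u - F_transform M v) - (u - v))"
    by (rule order_trans[OF _ norm_triangle_ineq])
      (simp add: h_tilde_def algebra_simps flip: mult_2)
  then have "cmod (h_tilde M u - h_tilde M v)
      \<le> 2 * cmod (u - v) + cmod ((F_transform M u - F_transform M v) - (u - v))"
    by (simp only: norm_mult) simp
  then have "cmod (h_tilde M u - h_tilde M v) \<le> cmod (u - v) * (2 + sqrt (?x * ?y))"
    using norm_F_transform_diff_minus_diff_le[OF assms] by (simp add: norm_mult distrib_left)
  ultimately show ?thesis
    by (meson mult_left_mono norm_ge_zero order_trans)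
qed

lemma norm_h_fun_diff_le:
  assumes "0 < Im u" "0 < Im v"
  shows "cmod (h_fun M u - h_fun M v)
    \<le> cmod (u - v) * sqrt (relative_excess M u * relative_excess M v)"
  using norm_F_transform_diff_minus_diff_le[OF assms]
  by (simp add: h_fun_def norm_minus_commute algebra_simps)

text \<open>The difference quotient of the Cauchy transform is minus the integral of a product of two kernels,
and this product integral is locally Lipschitz in either point.\<close>

lemma F_transform_holomorphic: "F_transform M holomorphic_on {z. 0 < Im z}"
proof -
  have "\<exists>D. (Cauchy_transform M has_field_derivative D) (at v)" if v: "0 < Im v" for v
  proof -
    let ?k = "\<lambda>u t. 1 / (u - complex_of_real t)"
    define K where "K u = (LINT t|M. ?k u t * ?k v t)" for u
    define C where "C = 2 / Im v * (1 / Im v * (1 / Im v))"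
    have ev: "\<forall>\<^sub>F u in at v. Im v / 2 < Im u"
      by (rule order_tendstoD[of Im "Im v"]) (use v in \<open>auto intro!: tendsto_intros\<close>)
    have lip: "cmod (K u - K v) \<le> cmod (u - v) * C" if u: "Im v / 2 < Im u" for u
    proof -
      have u0: "0 < Im u" using u v by linarith
      have eq: "?k u t * ?k v t - ?k v t * ?k v t = (v - u) * (?k u t * (?k v t * ?k v t))" for t
        using diff_of_real_nonzero[OF u0, of t] diff_of_real_nonzero[OF v, of t]
        by (simp add: divide_simps)
      have "K u - K v = (LINT t|M. ?k u t * ?k v t - ?k v t * ?k v t)"
        unfolding K_def
        by (rule Bochner_Integration.integral_diff[symmetric]; rule integrable_kernel_mult[OF _ v])
          (use u0 v in auto)
      then have "K u - K v = (LINT t|M. (v - u) * (?k u t * (?k v t * ?k v t)))"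
        by (simp only: eq)
      moreover have "cmod (LINT t|M. (v - u) * (?k u t * (?k v t * ?k v t))) \<le> cmod (u - v) * C"
      proof (rule order_trans[OF integral_norm_bound], rule integral_le_const)
        have "cmod (?k u t) \<le> 2 / Im v" for t
          by (rule order_trans[OF norm_kernel_le[OF u0]]) (use u v in \<open>simp add: field_simps\<close>)
        then have bd: "cmod ((v - u) * (?k u t * (?k v t * ?k v t))) \<le> cmod (u - v) * C" for t
          unfolding norm_mult C_def norm_minus_commute[of v u]
          by (intro mult_left_mono mult_mono norm_kernel_le v) (use v in auto)
        then show "AE t in M. cmod ((v - u) * (?k u t * (?k v t * ?k v t))) \<le> cmod (u - v) * C"
          by simp
        show "integrable M (\<lambda>t. cmod ((v - u) * (?k u t * (?k v t * ?k v t))))"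
          by (rule integrable_const_bound[of _ "cmod (u - v) * C"]) (use bd in auto)
      qed
      ultimately show ?thesis by simp
    qed
    have "((\<lambda>u. K u - K v) \<longlongrightarrow> 0) (at v)"
    proof (rule Lim_null_comparison)
      show "\<forall>\<^sub>F u in at v. cmod (K u - K v) \<le> cmod (u - v) * C"
        using ev by eventually_elim (rule lip)
      have "((\<lambda>u. cmod (u - v) * C) \<longlongrightarrow> cmod (v - v) * C) (at v)"
        by (intro tendsto_intros)
      then show "((\<lambda>u. cmod (u - v) * C) \<longlongrightarrow> 0) (at v)" by simp
    qed
    then have "(K \<longlongrightarrow> K v) (at v)"
      by (simp add: LIM_zero_iff)
    then have "((\<lambda>u. - K u) \<longlongrightarrow> - K v) (at v)"
      by (intro tendsto_intros)
    moreover have "\<forall>\<^sub>F u in at v. - K u = (Cauchy_transform M u - Cauchy_transform M v) / (u - v)"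
      using ev eventually_neq_at_within[of v v UNIV]
    proof eventually_elim
      case (elim u)
      then have "0 < Im u" using v by linarith
      then show ?case
        using Cauchy_transform_diff[of u v] v elim(2) by (simp add: K_def divide_simps) (simp add: algebra_simps)
    qed
    ultimately show ?thesis
      unfolding has_field_derivative_iff by (blast intro: Lim_transform_eventually)
  qed
  then have "Cauchy_transform M holomorphic_on {z. 0 < Im z}"
    unfolding holomorphic_on_def field_differentiable_def
    using has_field_derivative_at_within by blast
  then have "(\<lambda>z. 1 / Cauchy_transform M z) holomorphic_on {z. 0 < Im z}"
    using Cauchy_transform_nonzero by (intro holomorphic_intros) auto
  then show ?thesis
    by (simp add: F_transform_def[abs_def])
qed

end

section \<open>Distributions with finite variance\<close>

locale finite_variance_distribution = real_distribution +
  fixes m s :: real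
  assumes square_integrable: "integrable M (\<lambda>x. x\<^sup>2)"
    and mean: "m = expectation (\<lambda>x. x)"
    and s_nonneg: "0 \<le> s"
    and variance: "variance (\<lambda>x. x) = s\<^sup>2"
begin

lemma integrable_id: "integrable M (\<lambda>x. x)"
  using square_integrable by (rule square_integrable_imp_integrable[rotated]) simp

text \<open>The centred resolvent \<open>r\<close> satisfies \<open>t r(t) = z r(t) + z - F(z) - t\<close> and has mean zero, so
integrating leaves \<open>z - F(z) - m\<close>.\<close>

lemma h_fun_minus_mean:
  assumes "0 < Im z"
  shows "h_fun M z - of_real m = (LINT t|M. complex_of_real (t - m) * centred_resolvent M z t)"
proof -
  let ?g = "\<lambda>t. 1 / (z - complex_of_real t)"
  let ?F = "F_transform M z" and ?G = "Cauchy_transform M z"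
  have nz: "?G \<noteq> 0"
    using Cauchy_transform_nonzero assms by auto
  have eq: "complex_of_real (t - m) * centred_resolvent M z t
      = ?F * (z - m) * ?g t - ?F + of_real m - of_real t" for t
  proof -
    have "z \<noteq> complex_of_real t" using assms by (auto simp: complex_eq_iff)
    then show ?thesis by (simp add: centred_resolvent_def field_simps)
  qed
  have "(LINT t|M. complex_of_real (t - m) * centred_resolvent M z t)
      = ?F * (z - m) * ?G - ?F + of_real m - of_real m"
    unfolding eq Cauchy_transform_def
    using integrable_kernel[OF assms] integrable_id
    by (simp del: times_divide_times_eq times_divide_eq_right mult_1_right add: prob_space[unfolded space_eq_univ] mean)
  also have "\<dots> = h_fun M z - of_real m"
    using nz by (simp add: F_transform_def h_fun_def)
  finally show ?thesis by simp
qed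

lemma norm_h_fun_minus_mean_le_sqrt:
  assumes "0 < Im z"
  shows "cmod (h_fun M z - of_real m) \<le> s * sqrt (relative_excess M z)"
proof -
  have "(LINT t|M. (t - m)\<^sup>2) = s\<^sup>2"
    using variance by (simp add: mean)
  moreover have "integrable M (\<lambda>t. (t - m)\<^sup>2)"
    using square_integrable integrable_id by (simp add: power2_diff)
  ultimately show ?thesis
    unfolding h_fun_minus_mean[OF assms]
    using norm_integral_mult_le_sqrt[of "\<lambda>t. complex_of_real (t - m)" M "centred_resolvent M z"] assms s_nonneg
    by (simp add: integrable_norm_centred_resolvent_sq integral_norm_centred_resolvent_sq real_sqrt_mult
        flip: of_real_diff)
qed

text \<open>With \<open>x\<close> the norm of the centred resolvent, \<open>x\<^sup>2 Im z = - Im (h(z) - m) \<le> |h(z) - m| \<le> s x\<close>.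
So the \<open>L\<^sup>2\<close> bound on \<open>h\<close> improves itself to one that decays in \<open>Im z\<close>.\<close>

lemma sqrt_relative_excess_le:
  assumes "0 < Im z"
  shows "sqrt (relative_excess M z) \<le> s / Im z"
proof -
  let ?x = "sqrt (relative_excess M z)"
  have x: "0 \<le> ?x" using relative_excess_nonneg[OF assms] by simp
  have "?x * (?x * Im z) = relative_excess M z * Im z"
    using relative_excess_nonneg[OF assms] by (simp flip: mult.assoc)
  also have "\<dots> = - Im (h_fun M z - of_real m)"
    using assms by (simp add: relative_excess_def h_fun_def field_simps)
  also have "\<dots> \<le> ?x * s"
    using abs_Im_le_cmod[of "h_fun M z - of_real m"] norm_h_fun_minus_mean_le_sqrt[OF assms]
    by (simp add: mult.commute)
  finally have "?x * Im z \<le> s"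
    using x s_nonneg by (cases "?x = 0") (auto simp: mult_le_cancel_left)
  then show ?thesis using assms by (simp add: field_simps)
qed

lemma norm_h_fun_minus_mean_le:
  assumes "0 < Im z"
  shows "cmod (h_fun M z - of_real m) \<le> s\<^sup>2 / Im z"
proof -
  have "cmod (h_fun M z - of_real m) \<le> s * (s / Im z)"
    by (rule order_trans[OF norm_h_fun_minus_mean_le_sqrt[OF assms]])
      (intro mult_left_mono sqrt_relative_excess_le assms s_nonneg)
  then show ?thesis by (simp add: power2_eq_square)
qed

lemma h_fun_Lipschitz:
  assumes "0 < Im u" "0 < Im v"
  shows "cmod (h_fun M u - h_fun M v) \<le> cmod (u - v) * (s / Im u * (s / Im v))"
  by (rule order_trans[OF norm_h_fun_diff_le[OF assms]], unfold real_sqrt_mult)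
    (use assms s_nonneg relative_excess_nonneg in \<open>intro mult_left_mono mult_mono sqrt_relative_excess_le; simp\<close>)

end

section \<open>Values of inverses given by a Voiculescu transform\<close>

lemma Voiculescu_transform_onE:
  assumes "Voiculescu_transform_on \<mu> D \<phi>"
  obtains b where "0 < b"
    and "\<And>v. v \<in> D \<Longrightarrow> b < Im (v + \<phi> v) \<and> F_transform \<mu> (v + \<phi> v) = v"
proof -
  obtain \<alpha> b where b: "0 < b"
    and inj: "inj_on (F_transform \<mu>) (truncated_cone \<alpha> b)"
    and sub: "D \<subseteq> F_transform \<mu> ` truncated_cone \<alpha> b"
    and phi: "\<And>v. v \<in> D \<Longrightarrow> \<phi> v = the_inv_into (truncated_cone \<alpha> b) (F_transform \<mu>) v - v"
    using assms unfolding Voiculescu_transform_on_def by blast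
  have "b < Im (v + \<phi> v) \<and> F_transform \<mu> (v + \<phi> v) = v" if v: "v \<in> D" for v
  proof -
    have "the_inv_into (truncated_cone \<alpha> b) (F_transform \<mu>) v \<in> truncated_cone \<alpha> b"
      using sub v by (intro the_inv_into_into[OF inj]) auto
    moreover have "F_transform \<mu> (the_inv_into (truncated_cone \<alpha> b) (F_transform \<mu>) v) = v"
      using sub v by (intro f_the_inv_into_f[OF inj]) auto
    ultimately show ?thesis using phi[OF v] by (simp add: truncated_cone_def)
  qed
  then show ?thesis using that b by blast
qed

section \<open>The subordination map as a strict contraction\<close>

locale subordination =
  M\<^sub>1: finite_variance_distribution \<mu>\<^sub>1 m\<^sub>1 \<sigma>\<^sub>1 + M\<^sub>3: finite_variance_distribution \<mu>\<^sub>3 m\<^sub>3 \<sigma>\<^sub>3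
  for \<mu>\<^sub>1 m\<^sub>1 \<sigma>\<^sub>1 \<mu>\<^sub>3 m\<^sub>3 \<sigma>\<^sub>3
begin

abbreviation S :: "complex set" where "S \<equiv> half_plane (2 * sqrt 2 * \<sigma>\<^sub>1)"

abbreviation T :: "complex \<Rightarrow> complex \<Rightarrow> complex" where "T \<equiv> T_map \<mu>\<^sub>1 \<mu>\<^sub>3"

definition contraction_factor :: "complex \<Rightarrow> real" where
  "contraction_factor z = 8 * \<sigma>\<^sub>1\<^sup>2 / (Im z)\<^sup>2"

lemma S_D:
  assumes "z \<in> S"
  shows "0 < Im z" "8 * \<sigma>\<^sub>1\<^sup>2 < (Im z)\<^sup>2"
proof -
  have s: "0 \<le> 2 * sqrt 2 * \<sigma>\<^sub>1" and lt: "2 * sqrt 2 * \<sigma>\<^sub>1 < Im z"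
    using assms M\<^sub>1.s_nonneg by (auto simp: half_plane_def)
  show "0 < Im z" using s lt by linarith
  have "(2 * sqrt 2 * \<sigma>\<^sub>1)\<^sup>2 < (Im z)\<^sup>2"
    using s lt by (intro power_strict_mono) auto
  then show "8 * \<sigma>\<^sub>1\<^sup>2 < (Im z)\<^sup>2" by (simp add: power_mult_distrib)
qed

lemma contraction_factor_bounds:
  assumes "z \<in> S"
  shows "0 \<le> contraction_factor z" "contraction_factor z < 1"
  using S_D[OF assms] by (auto simp: contraction_factor_def)

lemma Im_h_tilde_ge: "0 < Im w \<Longrightarrow> 2 * Im w \<le> Im (h_tilde \<mu>\<^sub>3 w)"
  using M\<^sub>3.Im_F_transform_ge[of w] by (simp add: h_tilde_def)

lemma Im_inner_argument_ge:
  assumes "z \<in> S" "3 / 4 * Im z \<le> Im w"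
  shows "1 / 2 * Im z \<le> Im (h_tilde \<mu>\<^sub>3 w - z)"
  using Im_h_tilde_ge[of w] S_D[OF assms(1)] assms(2) by simp

text \<open>The range of the map lies in a fixed disc around \<open>z + m\<^sub>1\<close>. For \<open>z \<in> S\<close> its radius
is at most \<open>Im z / 4\<close>, which makes the half-plane \<open>Im w \<ge> 3 / 4 * Im z\<close> invariant and
also fixes the behaviour of the subordination functions at infinity.\<close>

lemma norm_T_map_minus_le:
  assumes z: "z \<in> S" and w: "3 / 4 * Im z \<le> Im w"
  shows "cmod (T z w - (z + of_real m\<^sub>1)) \<le> 2 * \<sigma>\<^sub>1\<^sup>2 / Im z"
proof -
  note y = S_D(1)[OF z] and u = Im_inner_argument_ge[OF z w]
  have "cmod (h_fun \<mu>\<^sub>1 (h_tilde \<mu>\<^sub>3 w - z) - of_real m\<^sub>1) \<le> \<sigma>\<^sub>1\<^sup>2 / Im (h_tilde \<mu>\<^sub>3 w - z)"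
    by (rule M\<^sub>1.norm_h_fun_minus_mean_le) (use y u in linarith)
  also have "\<dots> \<le> \<sigma>\<^sub>1\<^sup>2 / (1 / 2 * Im z)"
    by (rule divide_left_mono[OF u]) (use y u in auto)
  finally show ?thesis by (simp add: T_map_def mult.commute)
qed

lemma Im_T_map_ge:
  assumes z: "z \<in> S" and w: "3 / 4 * Im z \<le> Im w"
  shows "3 / 4 * Im z \<le> Im (T z w)"
proof -
  have "2 * \<sigma>\<^sub>1\<^sup>2 / Im z \<le> Im z / 4"
    using S_D[OF z] by (simp add: field_simps power2_eq_square)
  then have "\<bar>Im (T z w - (z + of_real m\<^sub>1))\<bar> \<le> Im z / 4"
    using abs_Im_le_cmod norm_T_map_minus_le[OF z w] by (meson order_trans)
  from abs_le_D2[OF this] show ?thesis by simp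
qed

text \<open>With \<open>y = Im z\<close>, \<open>a = Im w \<ge> 3 y / 4\<close> and \<open>X = Im (F(w) + w) \<ge> 2 a\<close> the claim
is \<open>X y\<^sup>2 \<le> 8 a (X - y)\<^sup>2\<close>. Its worst case is \<open>a = 3 y / 4\<close>, \<open>X = 3 y / 2\<close>, where equality holds;
this is where the factor \<open>8\<close>, and with it the threshold \<open>2 * sqrt 2 * \<sigma>\<^sub>1\<close>, comes from.\<close>

lemma contraction_weight_le:
  assumes z: "z \<in> S" and w: "3 / 4 * Im z \<le> Im w"
  shows "sqrt (2 + relative_excess \<mu>\<^sub>3 w) / Im (h_tilde \<mu>\<^sub>3 w - z) \<le> sqrt 8 / Im z"
proof -
  let ?y = "Im z" and ?a = "Im w" and ?X = "Im (h_tilde \<mu>\<^sub>3 w)"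
  have y: "0 < ?y" and a: "0 < ?a" using S_D[OF z] w by auto
  have X: "2 * ?a \<le> ?X" using Im_h_tilde_ge[OF a] .
  have U: "0 < ?X - ?y" using X w y by linarith
  have e: "2 + relative_excess \<mu>\<^sub>3 w = ?X / ?a"
    using a by (simp add: relative_excess_def h_tilde_def field_simps)
  \<comment> \<open>The product is \<open>6 (X - y)\<^sup>2 - X y\<close>; its first factor vanishes in the extremal case.\<close>
  have "0 \<le> (2 * ?X - 3 * ?y) * (3 * ?X - 2 * ?y)"
    using X w y by (intro mult_nonneg_nonneg) linarith+
  then have "?X * ?y \<le> 6 * (?X - ?y)\<^sup>2"
    by (simp add: power2_eq_square algebra_simps)
  then have "?X * ?y * ?y \<le> 6 * (?X - ?y)\<^sup>2 * ?y"
    using y by (intro mult_right_mono) auto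
  also have "\<dots> = 8 * (?X - ?y)\<^sup>2 * (3 / 4 * ?y)" by simp
  also have "\<dots> \<le> 8 * (?X - ?y)\<^sup>2 * ?a"
    using w by (intro mult_left_mono) auto
  finally have "?X * ?y\<^sup>2 \<le> 8 * ?a * (?X - ?y)\<^sup>2"
    by (simp add: power2_eq_square algebra_simps)
  then have "?X / ?a / (?X - ?y)\<^sup>2 \<le> 8 / ?y\<^sup>2"
    using y a U by (simp add: field_simps)
  then have "sqrt (?X / ?a / (?X - ?y)\<^sup>2) \<le> sqrt (8 / ?y\<^sup>2)"
    by (rule real_sqrt_le_mono)
  then show ?thesis
    using y U unfolding e by (simp add: real_sqrt_divide real_sqrt_mult)
qed

text \<open>Chain the Lipschitz bound of \<open>h\<close> for \<open>\<mu>\<^sub>1\<close> with that of \<open>F(w) + w\<close> for \<open>\<mu>\<^sub>3\<close>. The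
resulting factor splits into one weight for each of the two points. In each
weight \<open>Im F(w)\<close>, which may be large compared with \<open>Im w\<close>, enters the numerator under a square root
but the denominator linearly, so that it does no harm.\<close>

lemma T_map_contraction:
  assumes z: "z \<in> S" and a: "3 / 4 * Im z \<le> Im a" and b: "3 / 4 * Im z \<le> Im b"
  shows "dist (T z a) (T z b) \<le> contraction_factor z * dist a b"
proof -
  note y = S_D(1)[OF z]
  let ?u = "h_tilde \<mu>\<^sub>3 a - z" and ?v = "h_tilde \<mu>\<^sub>3 b - z"
  let ?x = "sqrt (2 + relative_excess \<mu>\<^sub>3 a)" and ?y = "sqrt (2 + relative_excess \<mu>\<^sub>3 b)"
  have a0: "0 < Im a" and b0: "0 < Im b" using y a b by auto
  have u: "0 < Im ?u" and v: "0 < Im ?v"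
    using Im_inner_argument_ge[OF z a] Im_inner_argument_ge[OF z b] y by linarith+
  have x0: "0 \<le> ?x" and y0: "0 \<le> ?y"
    using M\<^sub>3.relative_excess_nonneg a0 b0 by simp_all
  have "dist (T z a) (T z b) = cmod (h_fun \<mu>\<^sub>1 ?u - h_fun \<mu>\<^sub>1 ?v)"
    by (simp add: T_map_def dist_norm)
  also have "\<dots> \<le> cmod (?u - ?v) * (\<sigma>\<^sub>1 / Im ?u * (\<sigma>\<^sub>1 / Im ?v))"
    by (rule M\<^sub>1.h_fun_Lipschitz[OF u v])
  also have "\<dots> \<le> (cmod (a - b) * (?x * ?y)) * (\<sigma>\<^sub>1 / Im ?u * (\<sigma>\<^sub>1 / Im ?v))"
    using M\<^sub>3.norm_h_tilde_diff_le[OF a0 b0] u v M\<^sub>1.s_nonneg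
    by (intro mult_right_mono) (auto simp: real_sqrt_mult)
  also have "\<dots> = cmod (a - b) * \<sigma>\<^sub>1\<^sup>2 * (?x / Im ?u * (?y / Im ?v))"
    by (simp add: power2_eq_square)
  also have "\<dots> \<le> cmod (a - b) * \<sigma>\<^sub>1\<^sup>2 * (sqrt 8 / Im z * (sqrt 8 / Im z))"
    using u v y x0 y0
    by (intro mult_left_mono mult_mono contraction_weight_le z a b) auto
  also have "\<dots> = contraction_factor z * dist a b"
    by (simp add: contraction_factor_def dist_norm power2_eq_square)
  finally show ?thesis .
qed

lemma T_map_fixed_point_ex1:
  assumes z: "z \<in> S"
  shows "\<exists>!w. 3 / 4 * Im z \<le> Im w \<and> T z w = w"
proof -
  let ?H = "{w. 3 / 4 * Im z \<le> Im w}"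
  have "\<exists>!w\<in>?H. T z w = w"
  proof (rule Banach_fix[OF complete_eq_closed[THEN iffD2] _ contraction_factor_bounds[OF z]])
    show "closed ?H" by (rule closed_halfspace_Im_ge)
    show "?H \<noteq> {}" using S_D(1)[OF z] by (auto intro!: exI[of _ z])
  qed (use Im_T_map_ge[OF z] T_map_contraction[OF z] in auto)
  then show ?thesis by simp
qed

section \<open>The subordination functions\<close>

definition \<omega>\<^sub>3 :: "complex \<Rightarrow> complex" where
  "\<omega>\<^sub>3 z = (THE w. 3 / 4 * Im z \<le> Im w \<and> T z w = w)"

definition \<omega>\<^sub>1 :: "complex \<Rightarrow> complex" where
  "\<omega>\<^sub>1 z = h_tilde \<mu>\<^sub>3 (\<omega>\<^sub>3 z) - z"

lemma
  assumes "z \<in> S"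
  shows Im_omega3_ge: "3 / 4 * Im z \<le> Im (\<omega>\<^sub>3 z)"
    and T_map_omega3: "T z (\<omega>\<^sub>3 z) = \<omega>\<^sub>3 z"
  using theI'[OF T_map_fixed_point_ex1[OF assms]] by (simp_all add: \<omega>\<^sub>3_def)

lemma omega3_unique:
  assumes "z \<in> S" "3 / 4 * Im z \<le> Im w" "T z w = w"
  shows "w = \<omega>\<^sub>3 z"
  using T_map_fixed_point_ex1[OF assms(1)] Im_omega3_ge[OF assms(1)] T_map_omega3[OF assms(1)] assms(2,3)
  by blast

lemma Im_iterate_ge:
  assumes z: "z \<in> S" and w: "3 / 4 * Im z \<le> Im w"
  shows "3 / 4 * Im z \<le> Im ((T z ^^ n) w)"
  by (induction n) (use w Im_T_map_ge[OF z] in auto)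

lemma dist_iterate_omega3_le:
  assumes z: "z \<in> S" and w: "3 / 4 * Im z \<le> Im w"
  shows "dist ((T z ^^ n) w) (\<omega>\<^sub>3 z) \<le> contraction_factor z ^ n * dist w (\<omega>\<^sub>3 z)"
proof (induction n)
  case (Suc n)
  have "dist ((T z ^^ Suc n) w) (\<omega>\<^sub>3 z) = dist (T z ((T z ^^ n) w)) (T z (\<omega>\<^sub>3 z))"
    by (simp add: T_map_omega3[OF z])
  also have "\<dots> \<le> contraction_factor z * dist ((T z ^^ n) w) (\<omega>\<^sub>3 z)"
    by (intro T_map_contraction z Im_iterate_ge w Im_omega3_ge)
  also have "\<dots> \<le> contraction_factor z * (contraction_factor z ^ n * dist w (\<omega>\<^sub>3 z))"
    by (intro mult_left_mono Suc contraction_factor_bounds z)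
  finally show ?case by (simp add: mult.assoc)
qed simp

lemma iterates_tendsto_omega3:
  assumes z: "z \<in> S" and w: "3 / 4 * Im z \<le> Im w"
  shows "(\<lambda>n. (T z ^^ n) w) \<longlonglongrightarrow> \<omega>\<^sub>3 z"
proof (rule metric_tendsto_imp_tendsto)
  show "(\<lambda>n. contraction_factor z ^ n * dist w (\<omega>\<^sub>3 z)) \<longlonglongrightarrow> 0"
    by (intro tendsto_mult_left_zero LIMSEQ_power_zero) (use contraction_factor_bounds[OF z] in simp)
  show "\<forall>\<^sub>F n in sequentially. dist ((T z ^^ n) w) (\<omega>\<^sub>3 z)
      \<le> dist (contraction_factor z ^ n * dist w (\<omega>\<^sub>3 z)) 0"
    by (intro always_eventually allI order_trans[OF dist_iterate_omega3_le[OF z w]]) simp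
qed

lemma norm_omega3_minus_le:
  assumes "z \<in> S"
  shows "cmod (\<omega>\<^sub>3 z - (z + of_real m\<^sub>1)) \<le> 2 * \<sigma>\<^sub>1\<^sup>2 / Im z"
  using norm_T_map_minus_le[OF assms Im_omega3_ge[OF assms]] T_map_omega3[OF assms] by simp

lemma Im_omega1_ge:
  assumes "z \<in> S"
  shows "1 / 2 * Im z \<le> Im (\<omega>\<^sub>1 z)"
  using Im_inner_argument_ge[OF assms Im_omega3_ge[OF assms]] by (simp add: \<omega>\<^sub>1_def)

text \<open>This is the fixed point equation rewritten: \<open>\<omega>\<^sub>3 = \<omega>\<^sub>1 - F(\<omega>\<^sub>1) + z\<close> for the transform of
\<open>\<mu>\<^sub>1\<close>, while \<open>\<omega>\<^sub>1 - \<omega>\<^sub>3 + z\<close> is the transform of \<open>\<mu>\<^sub>3\<close> at \<open>\<omega>\<^sub>3\<close>.\<close>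

lemma F_transform_omega1_eq:
  assumes "z \<in> S"
  shows "F_transform \<mu>\<^sub>3 (\<omega>\<^sub>3 z) = F_transform \<mu>\<^sub>1 (\<omega>\<^sub>1 z)"
  using T_map_omega3[OF assms]
  by (simp add: T_map_def h_fun_def h_tilde_def \<omega>\<^sub>1_def algebra_simps)

lemma norm_omega1_minus_le:
  assumes z: "z \<in> S"
  shows "cmod (\<omega>\<^sub>1 z - (z + of_real (2 * m\<^sub>1 - m\<^sub>3))) \<le> (4 * \<sigma>\<^sub>1\<^sup>2 + 4 / 3 * \<sigma>\<^sub>3\<^sup>2) / Im z"
proof -
  note y = S_D(1)[OF z]
  have w: "0 < Im (\<omega>\<^sub>3 z)" using Im_omega3_ge[OF z] y by simp
  have "cmod (h_fun \<mu>\<^sub>3 (\<omega>\<^sub>3 z) - of_real m\<^sub>3) \<le> \<sigma>\<^sub>3\<^sup>2 / (3 / 4 * Im z)"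
    by (rule order_trans[OF M\<^sub>3.norm_h_fun_minus_mean_le[OF w]], rule divide_left_mono[OF Im_omega3_ge[OF z]])
      (use w y in auto)
  moreover have "\<omega>\<^sub>1 z - (z + of_real (2 * m\<^sub>1 - m\<^sub>3))
      = 2 * (\<omega>\<^sub>3 z - (z + of_real m\<^sub>1)) - (h_fun \<mu>\<^sub>3 (\<omega>\<^sub>3 z) - of_real m\<^sub>3)"
    by (simp add: \<omega>\<^sub>1_def h_tilde_def h_fun_def algebra_simps)
  then have "cmod (\<omega>\<^sub>1 z - (z + of_real (2 * m\<^sub>1 - m\<^sub>3)))
      \<le> cmod (2 * (\<omega>\<^sub>3 z - (z + of_real m\<^sub>1))) + cmod (h_fun \<mu>\<^sub>3 (\<omega>\<^sub>3 z) - of_real m\<^sub>3)"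
    by (metis norm_triangle_ineq4)
  then have "cmod (\<omega>\<^sub>1 z - (z + of_real (2 * m\<^sub>1 - m\<^sub>3)))
      \<le> 2 * cmod (\<omega>\<^sub>3 z - (z + of_real m\<^sub>1)) + cmod (h_fun \<mu>\<^sub>3 (\<omega>\<^sub>3 z) - of_real m\<^sub>3)"
    by (simp only: norm_mult) simp
  ultimately have "cmod (\<omega>\<^sub>1 z - (z + of_real (2 * m\<^sub>1 - m\<^sub>3)))
      \<le> 2 * (2 * \<sigma>\<^sub>1\<^sup>2 / Im z) + \<sigma>\<^sub>3\<^sup>2 / (3 / 4 * Im z)"
    using norm_omega3_minus_le[OF z] by linarith
  also have "\<dots> = (4 * \<sigma>\<^sub>1\<^sup>2 + 4 / 3 * \<sigma>\<^sub>3\<^sup>2) / Im z"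
    using y by (simp add: field_simps)
  finally show ?thesis .
qed

lemma tendsto_quotient_one:
  assumes bd: "\<And>z. z \<in> S \<Longrightarrow> cmod (\<omega> z - (z + of_real m)) \<le> C / Im z"
  shows "((\<lambda>y::real. \<omega> (\<i> * y) / (\<i> * y)) \<longlongrightarrow> 1) at_top"
proof -
  have "((\<lambda>y::real. \<omega> (\<i> * y) / (\<i> * y) - 1) \<longlongrightarrow> 0) at_top"
  proof (rule Lim_null_comparison)
    show "\<forall>\<^sub>F y::real in at_top. cmod (\<omega> (\<i> * y) / (\<i> * y) - 1) \<le> (C / y + \<bar>m\<bar>) / y"
      using eventually_gt_at_top[of "2 * sqrt 2 * \<sigma>\<^sub>1"]
    proof eventually_elim
      case (elim y)
      then have z: "\<i> * complex_of_real y \<in> S" by (simp add: half_plane_def)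
      have y: "0 < y" using S_D(1)[OF z] by simp
      have "cmod (\<omega> (\<i> * y) - \<i> * y) \<le> cmod (\<omega> (\<i> * y) - (\<i> * y + of_real m)) + cmod (of_real m)"
        by (rule order_trans[OF _ norm_triangle_ineq]) simp
      then have "cmod (\<omega> (\<i> * y) - \<i> * y) \<le> C / y + \<bar>m\<bar>"
        using bd[OF z] by simp
      moreover have "\<omega> (\<i> * y) / (\<i> * y) - 1 = (\<omega> (\<i> * y) - \<i> * y) / (\<i> * y)"
        using y by (simp add: diff_divide_distrib)
      then have "cmod (\<omega> (\<i> * y) / (\<i> * y) - 1) = cmod (\<omega> (\<i> * y) - \<i> * y) / y"
        using y by (simp only: norm_divide norm_mult) simp
      ultimately show ?case using y by (simp add: divide_right_mono)
    qed
    show "((\<lambda>y. (C / y + \<bar>m\<bar>) / y) \<longlongrightarrow> 0) at_top"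
      by real_asymp
  qed
  then show ?thesis by (simp add: LIM_zero_iff)
qed

section \<open>Holomorphy and the link with free convolution\<close>

lemma iterate_holomorphic: "(\<lambda>z. (T z ^^ n) z) holomorphic_on S"
proof (induction n)
  case (Suc n)
  let ?f = "\<lambda>z. (T z ^^ n) z"
  have im: "3 / 4 * Im z \<le> Im (?f z)" if "z \<in> S" for z
    using that S_D(1)[OF that] by (intro Im_iterate_ge) auto
  have im0: "0 < Im (?f z)" if "z \<in> S" for z
    using im[OF that] S_D(1)[OF that] by linarith
  have F3: "(\<lambda>z. F_transform \<mu>\<^sub>3 (?f z)) holomorphic_on S"
    using im0
    by (intro holomorphic_on_compose_gen[OF Suc M\<^sub>3.F_transform_holomorphic, unfolded o_def] image_subsetI) simp
  then have u: "(\<lambda>z. h_tilde \<mu>\<^sub>3 (?f z) - z) holomorphic_on S"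
    unfolding h_tilde_def by (intro holomorphic_intros Suc)
  have "0 < Im (h_tilde \<mu>\<^sub>3 (?f z) - z)" if "z \<in> S" for z
    using Im_inner_argument_ge[OF that im[OF that]] S_D(1)[OF that] by linarith
  then have "(\<lambda>z. F_transform \<mu>\<^sub>1 (h_tilde \<mu>\<^sub>3 (?f z) - z)) holomorphic_on S"
    by (intro holomorphic_on_compose_gen[OF u M\<^sub>1.F_transform_holomorphic, unfolded o_def] image_subsetI) simp
  then have "(\<lambda>z. T z (?f z)) holomorphic_on S"
    by (subst T_map_def, unfold h_fun_def) (intro holomorphic_intros u)
  then show ?case by simp
qed simp

lemma open_S: "open S"
  by (simp add: half_plane_def open_halfspace_Im_gt)

text \<open>The iterates started at \<open>w = z\<close> are holomorphic in \<open>z\<close>, and they converge locally uniformly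
because on a disc the contraction factor and the bound for the initial distance are largest where
\<open>Im z\<close> is smallest.\<close>

lemma omega3_holomorphic: "\<omega>\<^sub>3 holomorphic_on S"
proof (rule holomorphic_uniform_sequence[OF open_S iterate_holomorphic])
  fix z0 assume z0: "z0 \<in> S"
  define b where "b = 2 * sqrt 2 * \<sigma>\<^sub>1"
  have b: "0 \<le> b" "b < Im z0" "b\<^sup>2 = 8 * \<sigma>\<^sub>1\<^sup>2"
    using z0 M\<^sub>1.s_nonneg by (auto simp: half_plane_def b_def power_mult_distrib)
  \<comment> \<open>On the disc of this radius \<open>Im z\<close> is at least the midpoint \<open>y0\<close> between \<open>Im z0\<close> and the boundary value.\<close>
  define d where "d = (Im z0 - b) / 2"
  define y0 where "y0 = (Im z0 + b) / 2"
  have d: "0 < d" and y0: "0 < y0" "b < y0" using b by (auto simp: d_def y0_def)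
  define q where "q = 8 * \<sigma>\<^sub>1\<^sup>2 / y0\<^sup>2"
  have "b\<^sup>2 < y0\<^sup>2" using b y0 by (intro power_strict_mono) auto
  then have q: "0 \<le> q" "q < 1" using b y0 by (auto simp: q_def)
  define C where "C = 2 * \<sigma>\<^sub>1\<^sup>2 / y0 + \<bar>m\<^sub>1\<bar>"
  have im: "y0 \<le> Im z" if "z \<in> cball z0 d" for z
  proof -
    have "\<bar>Im (z0 - z)\<bar> \<le> d"
      using that abs_Im_le_cmod[of "z0 - z"] by (simp add: dist_norm)
    from abs_le_D1[OF this] have "Im z0 - Im z \<le> (Im z0 - b) / 2" unfolding d_def by simp
    then show ?thesis by (simp add: y0_def field_simps)
  qed
  have sub: "cball z0 d \<subseteq> S"
    using im y0 by (fastforce simp: half_plane_def b_def)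
  have bound: "dist ((T z ^^ n) z) (\<omega>\<^sub>3 z) \<le> q ^ n * C" if z: "z \<in> cball z0 d" for z n
  proof -
    have zS: "z \<in> S" using sub z by auto
    have y: "0 < Im z" using S_D(1)[OF zS] .
    have cf: "contraction_factor z \<le> q"
      unfolding contraction_factor_def q_def using im[OF z] y0 y
      by (intro divide_left_mono power_mono) auto
    have "cmod (\<omega>\<^sub>3 z - z) \<le> cmod (\<omega>\<^sub>3 z - (z + of_real m\<^sub>1)) + cmod (of_real m\<^sub>1)"
      by (rule order_trans[OF _ norm_triangle_ineq]) simp
    also have "\<dots> \<le> 2 * \<sigma>\<^sub>1\<^sup>2 / Im z + \<bar>m\<^sub>1\<bar>"
      using norm_omega3_minus_le[OF zS] by simp
    also have "\<dots> \<le> C"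
      unfolding C_def using im[OF z] y0 y by (intro add_right_mono divide_left_mono) auto
    finally have "dist z (\<omega>\<^sub>3 z) \<le> C" by (simp add: dist_norm norm_minus_commute)
    then have "contraction_factor z ^ n * dist z (\<omega>\<^sub>3 z) \<le> q ^ n * C"
      using cf contraction_factor_bounds[OF zS] q by (intro mult_mono power_mono) auto
    then show ?thesis
      using dist_iterate_omega3_le[OF zS, of z n] y by simp
  qed
  have "uniform_limit (cball z0 d) (\<lambda>n z. (T z ^^ n) z) \<omega>\<^sub>3 sequentially"
  proof (rule uniform_limitI)
    fix e :: real assume "0 < e"
    have "(\<lambda>n. q ^ n * C) \<longlonglongrightarrow> 0"
      by (intro tendsto_mult_left_zero LIMSEQ_power_zero) (use q in simp)
    then have "\<forall>\<^sub>F n in sequentially. q ^ n * C < e"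
      using \<open>0 < e\<close> by (rule order_tendstoD)
    then show "\<forall>\<^sub>F n in sequentially. \<forall>z\<in>cball z0 d. dist ((T z ^^ n) z) (\<omega>\<^sub>3 z) < e"
      by eventually_elim (use bound in \<open>meson le_less_trans\<close>)
  qed
  then show "\<exists>d. 0 < d \<and> cball z0 d \<subseteq> S \<and>
      uniform_limit (cball z0 d) (\<lambda>n z. (T z ^^ n) z) \<omega>\<^sub>3 sequentially"
    using d sub by blast
qed

text \<open>At \<open>v = \<i> s\<close> let \<open>u\<close>, \<open>z\<close>, \<open>w\<close> be the preimages of \<open>v\<close> under the reciprocal
Cauchy transforms of \<open>\<mu>\<^sub>1\<close>, \<open>\<mu>\<^sub>2\<close>, \<open>\<mu>\<^sub>3\<close> selected by the Voiculescu transforms. Additivity reads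
\<open>z = w - u + v\<close>, and this says exactly that \<open>w\<close> is a fixed point of the map with parameter \<open>z\<close>.
It is the fixed point \<open>\<omega>\<^sub>3 z\<close> because \<open>Im w\<close> is close to \<open>s\<close> for large \<open>s\<close>, whereas \<open>Im z \<le> s\<close>.\<close>

lemma subordination_on_imaginary_axis:
  assumes "real_distribution \<mu>\<^sub>2" and "free_additive_convolution \<mu>\<^sub>1 \<mu>\<^sub>2 \<mu>\<^sub>3"
  obtains s\<^sub>0 :: real and a :: "real \<Rightarrow> complex" where "\<And>s::real. s\<^sub>0 < s \<Longrightarrow> a s \<in> S \<and> F_transform \<mu>\<^sub>2 (a s) = \<i> * s
    \<and> F_transform \<mu>\<^sub>3 (\<omega>\<^sub>3 (a s)) = \<i> * s"
proof -
  interpret M\<^sub>2: real_distribution \<mu>\<^sub>2 by fact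
  obtain \<alpha> \<beta> \<phi>\<^sub>1 \<phi>\<^sub>2 \<phi>\<^sub>3 where \<alpha>: "0 < \<alpha>" and \<beta>: "0 < \<beta>"
    and V1: "Voiculescu_transform_on \<mu>\<^sub>1 (truncated_cone \<alpha> \<beta>) \<phi>\<^sub>1"
    and V2: "Voiculescu_transform_on \<mu>\<^sub>2 (truncated_cone \<alpha> \<beta>) \<phi>\<^sub>2"
    and V3: "Voiculescu_transform_on \<mu>\<^sub>3 (truncated_cone \<alpha> \<beta>) \<phi>\<^sub>3"
    and sum: "\<And>v. v \<in> truncated_cone \<alpha> \<beta> \<Longrightarrow> \<phi>\<^sub>3 v = \<phi>\<^sub>1 v + \<phi>\<^sub>2 v"
    using assms(2) unfolding free_additive_convolution_def by blast
  obtain b\<^sub>1 where b1: "0 < b\<^sub>1" and a1: "\<And>v. v \<in> truncated_cone \<alpha> \<beta> \<Longrightarrow>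
      b\<^sub>1 < Im (v + \<phi>\<^sub>1 v) \<and> F_transform \<mu>\<^sub>1 (v + \<phi>\<^sub>1 v) = v"
    using Voiculescu_transform_onE[OF V1] by blast
  obtain b\<^sub>2 where b2: "0 < b\<^sub>2" and a2: "\<And>v. v \<in> truncated_cone \<alpha> \<beta> \<Longrightarrow>
      b\<^sub>2 < Im (v + \<phi>\<^sub>2 v) \<and> F_transform \<mu>\<^sub>2 (v + \<phi>\<^sub>2 v) = v"
    using Voiculescu_transform_onE[OF V2] by blast
  obtain b\<^sub>3 where b3: "0 < b\<^sub>3" and a3: "\<And>v. v \<in> truncated_cone \<alpha> \<beta> \<Longrightarrow>
      b\<^sub>3 < Im (v + \<phi>\<^sub>3 v) \<and> F_transform \<mu>\<^sub>3 (v + \<phi>\<^sub>3 v) = v"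
    using Voiculescu_transform_onE[OF V3] by blast
  \<comment> \<open>The three entries give \<open>\<i> s\<close> in the cone, \<open>3 s / 4 \<le> Im w\<close>, and \<open>z \<in> S\<close>.\<close>
  define s\<^sub>0 where "s\<^sub>0 = Max {\<beta>, 4 * (\<sigma>\<^sub>3\<^sup>2 / b\<^sub>3), 4 / 3 * (2 * sqrt 2 * \<sigma>\<^sub>1)}"
  define a where "a s = \<i> * complex_of_real s + \<phi>\<^sub>2 (\<i> * complex_of_real s)" for s
  have "a s \<in> S \<and> F_transform \<mu>\<^sub>2 (a s) = \<i> * s \<and> F_transform \<mu>\<^sub>3 (\<omega>\<^sub>3 (a s)) = \<i> * s"
    if s: "s\<^sub>0 < s" for s
  proof -
    let ?v = "\<i> * complex_of_real s"
    let ?w = "?v + \<phi>\<^sub>3 ?v" and ?u = "?v + \<phi>\<^sub>1 ?v"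
    have s\<beta>: "\<beta> < s" and s3: "4 * (\<sigma>\<^sub>3\<^sup>2 / b\<^sub>3) < s" and s1: "2 * sqrt 2 * \<sigma>\<^sub>1 < 3 / 4 * s"
      using s by (auto simp: s\<^sub>0_def)
    have v: "?v \<in> truncated_cone \<alpha> \<beta>"
      using s\<beta> \<beta> \<alpha> by (simp add: truncated_cone_def)
    have z0: "0 < Im (a s)" and F2: "F_transform \<mu>\<^sub>2 (a s) = ?v"
      using a2[OF v] b2 by (auto simp: a_def)
    have u0: "0 < Im ?u" and F1: "F_transform \<mu>\<^sub>1 ?u = ?v"
      using a1[OF v] b1 by auto
    have w0: "b\<^sub>3 < Im ?w" and F3: "F_transform \<mu>\<^sub>3 ?w = ?v"
      using a3[OF v] by auto
    have "- Im (h_fun \<mu>\<^sub>3 ?w - of_real m\<^sub>3) \<le> \<sigma>\<^sub>3\<^sup>2 / Im ?w"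
      using M\<^sub>3.norm_h_fun_minus_mean_le[of ?w] abs_Im_le_cmod[of "h_fun \<mu>\<^sub>3 ?w - of_real m\<^sub>3"] w0 b3
      by linarith
    also have "\<dots> \<le> \<sigma>\<^sub>3\<^sup>2 / b\<^sub>3"
      using w0 b3 by (intro divide_left_mono) auto
    finally have "3 / 4 * s \<le> Im ?w"
      using s3 by (simp add: h_fun_def F3)
    moreover have "Im ?u \<le> s"
      using M\<^sub>1.Im_F_transform_ge[OF u0] F1 by simp
    moreover have zuw: "a s = ?w - ?u + ?v"
      using sum[OF v] by (simp add: a_def)
    then have "Im (a s) = Im ?w - Im ?u + s" by simp
    ultimately have "3 / 4 * s \<le> Im (a s)" and w: "3 / 4 * s \<le> Im ?w" by linarith+
    then have zS: "a s \<in> S" using s1 by (simp add: half_plane_def)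
    have "Im (a s) \<le> s"
      using M\<^sub>2.Im_F_transform_ge[OF z0] F2 by simp
    then have "3 / 4 * Im (a s) \<le> Im ?w" using w by linarith
    moreover have "h_tilde \<mu>\<^sub>3 ?w - a s = ?u"
      using zuw by (simp add: h_tilde_def F3)
    then have "T (a s) ?w = h_fun \<mu>\<^sub>1 ?u + a s"
      by (simp only: T_map_def)
    then have "T (a s) ?w = ?w"
      unfolding h_fun_def F1 zuw by simp
    ultimately have "?w = \<omega>\<^sub>3 (a s)" by (rule omega3_unique[OF zS])
    then show ?thesis using zS F2 F3 by simp
  qed
  then show ?thesis using that by blast
qed

text \<open>The points \<open>a s\<close> are pairwise distinct because the transform of \<open>\<mu>\<^sub>2\<close> takes distinct values at
them. So there are uncountably many, and two holomorphic functions on a connected open set that agree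
on an uncountable subset are equal.\<close>

lemma F_transform_subordination:
  assumes "real_distribution \<mu>\<^sub>2" and "free_additive_convolution \<mu>\<^sub>1 \<mu>\<^sub>2 \<mu>\<^sub>3" and z: "z \<in> S"
  shows "F_transform \<mu>\<^sub>2 z = F_transform \<mu>\<^sub>3 (\<omega>\<^sub>3 z)"
proof -
  interpret M\<^sub>2: real_distribution \<mu>\<^sub>2 by fact
  obtain s\<^sub>0 :: real and a :: "real \<Rightarrow> complex" where a: "\<And>s::real. s\<^sub>0 < s \<Longrightarrow> a s \<in> S \<and> F_transform \<mu>\<^sub>2 (a s) = \<i> * s
      \<and> F_transform \<mu>\<^sub>3 (\<omega>\<^sub>3 (a s)) = \<i> * s"
    using subordination_on_imaginary_axis[OF assms(1,2)] by blast
  let ?E = "{z \<in> S. F_transform \<mu>\<^sub>2 z = F_transform \<mu>\<^sub>3 (\<omega>\<^sub>3 z)}"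
  have "inj_on a {s\<^sub>0<..}"
    by (rule inj_onI) (metis a greaterThan_iff mult_cancel_left complex_i_not_zero of_real_eq_iff)
  moreover have "uncountable {s\<^sub>0<..}"
    using uncountable_open_interval[of s\<^sub>0 "s\<^sub>0 + 1"] countable_subset[of "{s\<^sub>0<..<s\<^sub>0 + 1}" "{s\<^sub>0<..}"]
    by (auto simp: subset_iff)
  moreover have "a ` {s\<^sub>0<..} \<subseteq> ?E" using a by auto
  ultimately have unc: "uncountable ?E"
    by (meson countable_image_inj_on countable_subset countable_image_inj_eq)
  have "S \<subseteq> ?E"
  proof (rule holomorphic_countable_equal[OF _ _ open_S _ _ unc])
    show "F_transform \<mu>\<^sub>2 holomorphic_on S"
      by (rule holomorphic_on_subset[OF M\<^sub>2.F_transform_holomorphic]) (use S_D(1) in auto)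
    have "0 < Im (\<omega>\<^sub>3 z)" if "z \<in> S" for z
      using Im_omega3_ge[OF that] S_D(1)[OF that] by linarith
    then show "(\<lambda>z. F_transform \<mu>\<^sub>3 (\<omega>\<^sub>3 z)) holomorphic_on S"
      by (intro holomorphic_on_compose_gen[OF omega3_holomorphic M\<^sub>3.F_transform_holomorphic, unfolded o_def]
          image_subsetI) simp
    show "connected S"
      unfolding half_plane_def by (intro convex_connected convex_halfspace_Im_gt)
    show "fsigma S"
    proof (rule open_Union_compact_subsets[OF open_S])
      fix C :: "nat \<Rightarrow> complex set"
      assume "\<And>n. compact (C n)" "\<Union>(range C) = S"
      then show "fsigma S"
        unfolding fsigma_Union_compact by (intro exI[of _ C]) auto
    qed
  qed
  then show ?thesis using z by blast
qed

end

theorem theorem1p2: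
  fixes \<mu>\<^sub>1 \<mu>\<^sub>3 :: "real measure" and \<sigma>\<^sub>1 \<sigma>\<^sub>3 :: real
  assumes "real_distribution \<mu>\<^sub>1" and "real_distribution \<mu>\<^sub>3"
    and "integrable \<mu>\<^sub>1 (\<lambda>x. x\<^sup>2)" and "integrable \<mu>\<^sub>3 (\<lambda>x. x\<^sup>2)"
    and "0 \<le> \<sigma>\<^sub>1" and "prob_space.variance \<mu>\<^sub>1 (\<lambda>x. x) = \<sigma>\<^sub>1\<^sup>2"
    and "0 \<le> \<sigma>\<^sub>3" and "prob_space.variance \<mu>\<^sub>3 (\<lambda>x. x) = \<sigma>\<^sub>3\<^sup>2"
  defines "S \<equiv> half_plane (2 * sqrt 2 * \<sigma>\<^sub>1)"
  shows "\<exists>!(\<omega>\<^sub>1, \<omega>\<^sub>3).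
    \<omega>\<^sub>1 \<in> S \<rightarrow>\<^sub>E half_plane 0 \<and> \<omega>\<^sub>3 \<in> S \<rightarrow>\<^sub>E half_plane 0 \<and>
    (\<forall>\<omega>\<in>{\<omega>\<^sub>1, \<omega>\<^sub>3}. (\<forall>z\<in>S. Im (\<omega> z) \<ge> 1 / 2 * Im z) \<and>
      ((\<lambda>y::real. \<omega> (\<i> * y) / (\<i> * y)) \<longlongrightarrow> 1) at_top) \<and>
    (\<forall>\<mu>\<^sub>2 :: real measure.
      real_distribution \<mu>\<^sub>2 \<and> free_additive_convolution \<mu>\<^sub>1 \<mu>\<^sub>2 \<mu>\<^sub>3 \<longrightarrow>
      (\<forall>z\<in>S. F_transform \<mu>\<^sub>2 z = F_transform \<mu>\<^sub>3 (\<omega>\<^sub>3 z) \<and>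
             F_transform \<mu>\<^sub>3 (\<omega>\<^sub>3 z) = F_transform \<mu>\<^sub>1 (\<omega>\<^sub>1 z))) \<and>
    (\<forall>z\<in>S. \<omega>\<^sub>1 z - \<omega>\<^sub>3 z = F_transform \<mu>\<^sub>3 (\<omega>\<^sub>3 z) - z) \<and>
    (\<forall>z\<in>S. \<forall>w. Im w > 3 / 4 * Im z \<longrightarrow>
      (\<lambda>n. (T_map \<mu>\<^sub>1 \<mu>\<^sub>3 z ^^ n) w) \<longlonglongrightarrow> \<omega>\<^sub>3 z)"
    (is "\<exists>!(\<omega>\<^sub>1, \<omega>\<^sub>3). ?P \<omega>\<^sub>1 \<omega>\<^sub>3")
proof -
  interpret subordination \<mu>\<^sub>1 "\<integral>x. x \<partial>\<mu>\<^sub>1" \<sigma>\<^sub>1 \<mu>\<^sub>3 "\<integral>x. x \<partial>\<mu>\<^sub>3" \<sigma>\<^sub>3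
    using assms(1-8)
    by (intro subordination.intro finite_variance_distribution.intro finite_variance_distribution_axioms.intro)
      (assumption | rule refl)+
  let ?\<omega>\<^sub>1 = "restrict \<omega>\<^sub>1 S" and ?\<omega>\<^sub>3 = "restrict \<omega>\<^sub>3 S"
  have pos: "0 < Im (\<omega>\<^sub>1 z)" "0 < Im (\<omega>\<^sub>3 z)" "1 / 2 * Im z \<le> Im (\<omega>\<^sub>3 z)" if "z \<in> S" for z
    using that Im_omega1_ge[of z] Im_omega3_ge[of z] S_D(1)[of z] by (auto simp: S_def)
  have asymptotics: "((\<lambda>y::real. restrict \<omega> S (\<i> * y) / (\<i> * y)) \<longlongrightarrow> 1) at_top"
    if "\<And>z. z \<in> S \<Longrightarrow> cmod (\<omega> z - (z + complex_of_real m)) \<le> C / Im z" for \<omega> m C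
    by (rule tendsto_quotient_one[of _ m C]) (use that in \<open>auto simp: S_def\<close>)
  have P: "?P ?\<omega>\<^sub>1 ?\<omega>\<^sub>3"
  proof (intro conjI)
    show "?\<omega>\<^sub>1 \<in> S \<rightarrow>\<^sub>E half_plane 0" "?\<omega>\<^sub>3 \<in> S \<rightarrow>\<^sub>E half_plane 0"
      using pos by (auto simp: half_plane_def[of 0])
    show "\<forall>\<omega>\<in>{?\<omega>\<^sub>1, ?\<omega>\<^sub>3}. (\<forall>z\<in>S. 1 / 2 * Im z \<le> Im (\<omega> z)) \<and>
        ((\<lambda>y::real. \<omega> (\<i> * y) / (\<i> * y)) \<longlongrightarrow> 1) at_top"
      using pos(3) Im_omega1_ge asymptotics[OF norm_omega1_minus_le] asymptotics[OF norm_omega3_minus_le]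
      by (simp add: S_def del: of_real_diff)
    show "\<forall>\<mu>\<^sub>2 :: real measure.
        real_distribution \<mu>\<^sub>2 \<and> free_additive_convolution \<mu>\<^sub>1 \<mu>\<^sub>2 \<mu>\<^sub>3 \<longrightarrow>
        (\<forall>z\<in>S. F_transform \<mu>\<^sub>2 z = F_transform \<mu>\<^sub>3 (?\<omega>\<^sub>3 z) \<and>
          F_transform \<mu>\<^sub>3 (?\<omega>\<^sub>3 z) = F_transform \<mu>\<^sub>1 (?\<omega>\<^sub>1 z))"
      using F_transform_omega1_eq F_transform_subordination by (simp add: S_def)
    show "\<forall>z\<in>S. ?\<omega>\<^sub>1 z - ?\<omega>\<^sub>3 z = F_transform \<mu>\<^sub>3 (?\<omega>\<^sub>3 z) - z"
      by (simp add: \<omega>\<^sub>1_def h_tilde_def)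
    show "\<forall>z\<in>S. \<forall>w. 3 / 4 * Im z < Im w \<longrightarrow>
        (\<lambda>n. (T_map \<mu>\<^sub>1 \<mu>\<^sub>3 z ^^ n) w) \<longlonglongrightarrow> ?\<omega>\<^sub>3 z"
      using iterates_tendsto_omega3 by (simp add: S_def)
  qed
  have uniq: "\<omega> = ?\<omega>\<^sub>1 \<and> \<omega>' = ?\<omega>\<^sub>3" if P': "?P \<omega> \<omega>'" for \<omega> \<omega>'
  proof -
    have eq3: "\<omega>' z = \<omega>\<^sub>3 z" if z: "z \<in> S" for z
    proof -
      have w: "3 / 4 * Im z < Im z" using S_D(1)[of z] z by (simp add: S_def)
      then have "(\<lambda>n. (T_map \<mu>\<^sub>1 \<mu>\<^sub>3 z ^^ n) z) \<longlonglongrightarrow> \<omega>' z"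
        using P' z by blast
      moreover have "(\<lambda>n. (T_map \<mu>\<^sub>1 \<mu>\<^sub>3 z ^^ n) z) \<longlonglongrightarrow> \<omega>\<^sub>3 z"
        using iterates_tendsto_omega3[of z z] z w by (simp add: S_def)
      ultimately show ?thesis by (rule LIMSEQ_unique)
    qed
    have "\<omega> z = \<omega>\<^sub>1 z" if z: "z \<in> S" for z
    proof -
      have "\<omega> z - \<omega>' z = F_transform \<mu>\<^sub>3 (\<omega>' z) - z" using P' z by blast
      then show ?thesis using eq3[OF z] by (simp add: \<omega>\<^sub>1_def h_tilde_def algebra_simps)
    qed
    moreover have "\<omega> \<in> extensional S" "\<omega>' \<in> extensional S" 
      using P'[THEN conjunct1] P'[THEN conjunct2, THEN conjunct1] by (simp_all only: PiE_iff)
    ultimately show ?thesis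
      using eq3 by (intro conjI extensionalityI[where A = S]) simp_all
  qed
  show ?thesis
  proof (rule ex1I[of _ "(?\<omega>\<^sub>1, ?\<omega>\<^sub>3)"])
    show "case (?\<omega>\<^sub>1, ?\<omega>\<^sub>3) of (f, g) \<Rightarrow> ?P f g"
      unfolding prod.case by (rule P)
    fix p assume p: "case p of (f, g) \<Rightarrow> ?P f g"
    obtain f g where fg: "p = (f, g)" by (cases p)
    have "?P f g" using p unfolding fg prod.case .
    from uniq[OF this] show "p = (?\<omega>\<^sub>1, ?\<omega>\<^sub>3)" by (simp only: fg)
  qed
qed

end
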